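(* Let $r \geq 2$ be an integer and let $b_0$ be the unique real root with $b_0>1$ of the polynomial $b^r-2rb+r-1$. Then there exists a partition $\mathbb{N}=A_1\sqcup\cdots\sqcup A_r$ of the positive integers into $r$ parts such that $$\max_{i\in[r]}\bar{d}_{\ell}(\Sigma(A_i)) \le \left(1-\frac{1}{2b_0}\right)\left(1+\frac{1}{2rb_0-r}\right);$$ that is, $c_r \le \left(1-\frac{1}{2b_0}\right)\left(1+\frac{1}{2rb_0-r}\right)$. Moreover, for $r=2$ this bound is tight: for every partition $\mathbb{N}=A_1\sqcup A_2$ there is some $i\in\{1,2\}$ with $\bar{d}_{\ell}(\Sigma(A_i))\ge (2+\sqrt{3})/4$, so that $c_2=(2+\sqrt{3})/4$.
   Context: $\mathbb{N}$ denotes the set of positive integers and $[r]=\{1,\dots,r\}$. For a set $A$ of positive integers and $x>1$, the logarithmic density of $A$ up to $x$ is $d_\ell(A;x)=\frac{1}{\log x}\sum_{a\in A,\,a\le x}\frac1a$ (natural logarithm), and the upper logarithmic density is $\bar d_\ell(A)=\limsup_{x\to\infty}d_\ell(A;x)$. For a set $A$ of integers, $\Sigma(A)=\{\sum_{s\in S}s : S\subseteq A\}$ is the set of sums of distinct elements of $A$ (subset sums). The quantity $c_r$ is the minimum, over all partitions $\mathbb{N}=A_1\sqcup\cdots\sqcup A_r$ into $r$ parts, of $\max_{i\in[r]}\bar d_\ell(\Sigma(A_i))$. *)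

theory Defs
  imports "HOL-Analysis.Analysis" "HOL-Library.Disjoint_Sets"
begin

text \<open>Sets of integers are modelled as \<^typ>\<open>nat set\<close>. Subset sums contain 0 (the empty sum), which
  the logarithmic density ignores. Only finite subsets have a sum.\<close>

definition subset_sums :: "nat set \<Rightarrow> nat set" where
  "subset_sums A = {\<Sum>S | S. S \<subseteq> A \<and> finite S}"

text \<open>Only the values at \<open>x > 1\<close> are meaningful.\<close>

definition log_density :: "nat set \<Rightarrow> real \<Rightarrow> real" where
  "log_density A x = (1 / ln x) * (\<Sum>a | a \<in> A \<and> 0 < a \<and> real a \<le> x. 1 / real a)"

definition upper_log_density :: "nat set \<Rightarrow> ereal" where
  "upper_log_density A = Limsup at_top (\<lambda>x. ereal (log_density A x))"

text \<open>Partitions into \<open>r\<close> parts are indexed by \<open>{1..r}\<close>, and parts may be empty, as for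
  \<open>r\<close>-colourings.\<close>

definition partition_of_positives :: "nat \<Rightarrow> (nat \<Rightarrow> nat set) \<Rightarrow> bool" where
  "partition_of_positives r A \<longleftrightarrow>
     disjoint_family_on A {1..r} \<and> (\<Union>i\<in>{1..r}. A i) = {n. 0 < n}"

definition max_density :: "nat \<Rightarrow> (nat \<Rightarrow> nat set) \<Rightarrow> ereal" where
  "max_density r A = (MAX i\<in>{1..r}. upper_log_density (subset_sums (A i)))"

text \<open>The minimum is rendered as an infimum, which agrees with the minimum whenever it is attained.\<close>

definition c_min :: "nat \<Rightarrow> ereal" where
  "c_min r = Inf {max_density r A | A. partition_of_positives r A}"

definition is_b0 :: "nat \<Rightarrow> real \<Rightarrow> bool" where
  "is_b0 r b \<longleftrightarrow> b > 1 \<and> b ^ r - 2 * real r * b + real r - 1 = 0"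

definition density_bound :: "nat \<Rightarrow> real \<Rightarrow> real" where
  "density_bound r b = (1 - 1 / (2 * b)) * (1 + 1 / (2 * real r * b - real r))"

end

theory Submission
  imports Defs "HOL-Real_Asymp.Real_Asymp"
begin

text \<open>
  Upper bound: colour \<open>n\<close> by the residue mod \<open>r\<close> of the index \<open>k\<close> with \<open>b ^ k \<le> ln n < b ^ (k + 1)\<close>.
  A subset sum with largest element \<open>e\<close> lies between \<open>e\<close> and \<open>e\<^sup>2\<close>, so on the logarithmic scale the
  sums of one colour are covered by the intervals from \<open>b ^ k\<close> to \<open>2 * b ^ (k + 1)\<close> with \<open>k\<close> in one
  residue class. The choice \<open>b = b0\<close> makes the density bound of these unions optimal.

  Lower bound: for each large \<open>m\<close> the subset sums of one of the two colours contain every integer from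
  \<open>m\<close> to \<open>m\<^sup>2\<close>, up to factors logarithmic in \<open>m\<close>. Indeed, disjoint pairs \<open>a\<close>, \<open>a + d\<close> of one colour whose
  differences \<open>d\<close> grow geometrically produce a long run of consecutive sums after logarithmically
  many steps, and if one colour lacks such pairs then the other one has pairs with any
  prescribed difference. Hence if \<open>x \<le> y\<close> are missed by different colours, then \<open>y\<close> is nearly at
  least \<open>x\<^sup>2\<close>. The missing sums of the two colours thus come in alternating clusters. If both sets
  of missing sums had logarithmic density above \<open>c > (2 - sqrt 3) / 4\<close>, the partial sums \<open>P k\<close> of
  the logarithms of the cluster positions of one parity would satisfy
  \<open>c * (P (k + 2) - P k) \<le> P (k + 1) / 2 - P k\<close> up to small errors, a recurrence whose
  characteristic polynomial has no real roots and hence without positive solutions.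
\<close>

subsection \<open>Runs of consecutive subset sums\<close>

definition sums_run :: "nat set \<Rightarrow> nat \<Rightarrow> nat \<Rightarrow> bool" where
  "sums_run X s l \<longleftrightarrow> finite X \<and> (\<forall>j\<le>l. \<exists>S\<subseteq>X. \<Sum>S = s + j)"

lemma sums_run_insert:
  assumes "sums_run X s l" "e \<notin> X" "e \<le> l + 1"
  shows "sums_run (insert e X) s (l + e)"
  unfolding sums_run_def
proof (intro conjI allI impI)
  show "finite (insert e X)"
    using assms(1) by (simp add: sums_run_def)
  fix j assume j: "j \<le> l + e"
  show "\<exists>S\<subseteq>insert e X. \<Sum>S = s + j"
  proof (cases "j \<le> l")
    case True
    then show ?thesis
      using assms(1) unfolding sums_run_def by (meson subset_insertI2)
  next
    case False
    then have "j - e \<le> l" "e \<le> j"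
      using j assms(3) by auto
    then obtain S where S: "S \<subseteq> X" "\<Sum>S = s + (j - e)"
      using assms(1) unfolding sums_run_def by meson
    moreover have "finite S" "e \<notin> S"
      using S assms(1,2) by (auto simp: sums_run_def intro: finite_subset)
    ultimately show ?thesis
      using \<open>e \<le> j\<close> by (intro exI[of _ "insert e S"]) auto
  qed
qed

text \<open>Each sum uses exactly one of \<open>a\<close> and \<open>a + d\<close>. So only the
  difference \<open>d\<close> has to fit the run, while the possibly much larger \<open>a\<close>
  merely moves its start.\<close>

lemma sums_run_insert_pair:
  assumes "sums_run X s l" "a \<notin> X" "a + d \<notin> X" "0 < d" "d \<le> l + 1"
  shows "sums_run (insert a (insert (a + d) X)) (s + a) (l + d)"
  unfolding sums_run_def
proof (intro conjI allI impI)
  show "finite (insert a (insert (a + d) X))"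
    using assms(1) by (simp add: sums_run_def)
  fix j assume j: "j \<le> l + d"
  show "\<exists>S\<subseteq>insert a (insert (a + d) X). \<Sum>S = s + a + j"
  proof (cases "j \<le> l")
    case True
    then obtain S where S: "S \<subseteq> X" "\<Sum>S = s + j"
      using assms(1) unfolding sums_run_def by meson
    moreover have "finite S" "a \<notin> S"
      using S assms(1,2) by (auto simp: sums_run_def intro: finite_subset)
    ultimately show ?thesis
      by (intro exI[of _ "insert a S"]) auto
  next
    case False
    then have "j - d \<le> l" "d \<le> j"
      using j assms(5) by auto
    then obtain S where S: "S \<subseteq> X" "\<Sum>S = s + (j - d)"
      using assms(1) unfolding sums_run_def by meson
    moreover have "finite S" "a + d \<notin> S"
      using S assms(1,3) by (auto simp: sums_run_def intro: finite_subset)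
    ultimately show ?thesis
      using \<open>d \<le> j\<close> by (intro exI[of _ "insert (a + d) S"]) auto
  qed
qed

text \<open>The run only lengthens as elements are added, so fitting the initial
  \<open>l + 1\<close> suffices throughout. This takes a run from length linear in \<open>m\<close>
  to quadratic.\<close>

lemma sums_run_union:
  assumes "finite E" "sums_run X s l" "E \<inter> X = {}" "\<And>e. e \<in> E \<Longrightarrow> e \<le> l + 1"
  shows "sums_run (E \<union> X) s (l + \<Sum>E)"
  using assms
proof (induction E rule: finite_induct)
  case (insert e E)
  then have "sums_run (E \<union> X) s (l + \<Sum>E)"
    by auto
  moreover have "e \<notin> E \<union> X" "e \<le> l + \<Sum>E + 1"
    using insert.hyps insert.prems by (auto intro: trans_le_add1 le_trans)
  ultimately show ?case
    using sums_run_insert[of "E \<union> X" s "l + \<Sum>E" e] insert.hyps by (simp add: add_ac)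
qed simp

lemma subset_sums_if_sums_run:
  assumes "sums_run X s l" "X \<subseteq> A" "s \<le> y" "y \<le> s + l"
  shows "y \<in> subset_sums A"
proof -
  obtain S where "S \<subseteq> X" "\<Sum>S = s + (y - s)"
    using assms unfolding sums_run_def by (metis add_le_cancel_left le_add_diff_inverse)
  then show ?thesis
    using assms unfolding subset_sums_def sums_run_def
    by (auto intro!: exI[of _ S] intro: finite_subset)
qed

text \<open>\<open>F\<close> stands for the elements already used: two for the start and two for
  each earlier step. Factor \<open>c = 2\<close> suffices for geometric growth; \<open>c = 1\<close>
  forces the difference \<open>t\<close> itself, in particular neighbours for
  \<open>t = 1\<close>.\<close>

definition rich_in_pairs :: "nat \<Rightarrow> nat \<Rightarrow> nat \<Rightarrow> nat set \<Rightarrow> bool" where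
  "rich_in_pairs c m N A \<longleftrightarrow>
     (\<forall>F t. finite F \<longrightarrow> card F \<le> 2 * N \<longrightarrow> 1 \<le> t \<longrightarrow> t \<le> m \<longrightarrow>
       (\<exists>a d. t \<le> d \<and> d \<le> c * t \<and> a + d \<le> 7 * m \<and> a \<in> A - F \<and> a + d \<in> A - F))"

lemma rich_in_pairs_mono:
  assumes "rich_in_pairs c m N A" "c \<le> c'"
  shows "rich_in_pairs c' m N A"
  using assms unfolding rich_in_pairs_def by (meson le_trans mult_le_mono1)

text \<open>Each step appends a pair whose difference lies between \<open>l / 4\<close> and
  \<open>l + 1\<close>, so the length grows by a factor of at least 5/4. The cap
  \<open>4 * m\<close> reflects that differences are only available at scales \<open>t\<close> up to
  \<open>m\<close>.\<close>

lemma sums_run_grow: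
  assumes rich: "rich_in_pairs 2 m N A"
    and X0: "sums_run X0 s0 1" "X0 \<subseteq> A" "card X0 \<le> 2" "s0 \<le> 7 * m"
    and "k \<le> N"
  shows "\<exists>X s l. sums_run X s l \<and> X \<subseteq> A \<and> card X \<le> 2 * (k + 1) \<and> s \<le> 7 * m * (k + 1) \<and>
           1 \<le> l \<and> min ((5 / 4) ^ k) (4 * real m) \<le> real l"
  using \<open>k \<le> N\<close>
proof (induction k)
  case 0
  show ?case
    using X0 by (intro exI[of _ X0] exI[of _ s0] exI[of _ 1]) auto
next
  case (Suc k)
  then obtain X s l where X: "sums_run X s l" "X \<subseteq> A" "card X \<le> 2 * (k + 1)"
      "s \<le> 7 * m * (k + 1)" and l: "1 \<le> l" "min ((5 / 4) ^ k) (4 * real m) \<le> real l"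
    by auto
  show ?case
  proof (cases "m = 0 \<or> 4 * m \<le> l")
    case True
    have "min ((5 / 4) ^ Suc k) (4 * real m) \<le> real l"
      using True by (auto simp: min_le_iff_disj simp flip: of_nat_mult)
    then show ?thesis
      using X l by (intro exI[of _ X] exI[of _ s] exI[of _ l]) auto
  next
    case False
    define t where "t = min ((l + 1) div 2) m"
    have t: "1 \<le> t" "t \<le> m" "2 * t \<le> l + 1" "l \<le> 4 * t"
      using l False by (auto simp: t_def min_def)
    have "finite X" "card X \<le> 2 * N"
      using X Suc.prems by (auto simp: sums_run_def)
    then obtain a d where d: "t \<le> d" "d \<le> 2 * t" "a + d \<le> 7 * m"
        and a: "a \<in> A - X" "a + d \<in> A - X"
      using rich t unfolding rich_in_pairs_def by meson
    have run: "sums_run (insert a (insert (a + d) X)) (s + a) (l + d)"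
      using X(1) a d t by (intro sums_run_insert_pair) auto
    have "card (insert a (insert (a + d) X)) \<le> 2 * (Suc k + 1)"
      using X \<open>finite X\<close> by (auto simp: card_insert_if)
    moreover have "s + a \<le> 7 * m * (Suc k + 1)"
      using X d by (simp add: algebra_simps)
    moreover have "min ((5 / 4) ^ Suc k) (4 * real m) \<le> real (l + d)"
    proof -
      have "(5 / 4) ^ k \<le> real l"
        using l(2) False by (auto simp: min_le_iff_disj)
      moreover have "real l \<le> 4 * real d"
        using t d by linarith
      ultimately show ?thesis
        by (simp add: min_le_iff_disj)
    qed
    ultimately show ?thesis
      using run X a l
      by (intro exI[of _ "insert a (insert (a + d) X)"] exI[of _ "s + a"] exI[of _ "l + d"]) auto
  qed
qed

lemma subset_sums_if_rich_in_pairs: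
  assumes rich: "rich_in_pairs 2 m N A"
    and start: "1 \<in> A \<or> (rich_in_pairs 1 m N A \<and> 0 < m)"
    and N: "4 * real m \<le> (5 / 4) ^ N"
    and many: "m \<le> 8 * card (A \<inter> {2 * m..<4 * m})" "32 * (N + 1) \<le> m"
    and y: "7 * m * (N + 1) \<le> y" "8 * y \<le> m\<^sup>2"
  shows "y \<in> subset_sums A"
proof -
  \<comment> \<open>The two consecutive sums are 0 and 1 if 1 is in \<open>A\<close>, and otherwise
    \<open>a\<close> and \<open>a + 1\<close> from a pair with difference exactly 1.\<close>
  have "\<exists>X0 s0. sums_run X0 s0 1 \<and> X0 \<subseteq> A \<and> card X0 \<le> 2 \<and> s0 \<le> 7 * m"
  proof (cases "1 \<in> A")
    case True
    have "sums_run {} 0 0"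
      by (simp add: sums_run_def)
    from sums_run_insert[OF this, of 1] have "sums_run {1} 0 1"
      by simp
    then show ?thesis
      using True by (intro exI[of _ "{1}"] exI[of _ 0]) auto
  next
    case False
    with start have "rich_in_pairs 1 m N A" "0 < m"
      by auto
    then obtain a d where "1 \<le> d" "d \<le> 1 * 1" "a + d \<le> 7 * m" "a \<in> A - {}" "a + d \<in> A - {}"
      unfolding rich_in_pairs_def
      by (metis One_nat_def Suc_leI card.empty finite.emptyI le0 le_refl)
    then have a: "a + 1 \<le> 7 * m" "a \<in> A" "a + 1 \<in> A"
      by (auto dest: le_antisym)
    have "sums_run {} 0 0"
      by (simp add: sums_run_def)
    from sums_run_insert_pair[OF this, of a 1] have "sums_run {a, a + 1} a 1"
      by simp
    then show ?thesis
      using a by (intro exI[of _ "{a, a + 1}"] exI[of _ a]) (auto simp: card_insert_if)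
  qed
  then obtain X s l where X: "sums_run X s l" "X \<subseteq> A" "card X \<le> 2 * (N + 1)"
      and s: "s \<le> 7 * m * (N + 1)" and l: "min ((5 / 4) ^ N) (4 * real m) \<le> real l"
    using sums_run_grow[OF rich, of _ _ N] by (metis le_refl)
  have "4 * m \<le> l"
    using l N by (simp add: min_absorb2 flip: of_nat_le_iff)
  define E where "E = A \<inter> {2 * m..<4 * m} - X"
  have "sums_run (E \<union> X) s (l + \<Sum>E)"
    using X \<open>4 * m \<le> l\<close> by (intro sums_run_union) (auto simp: E_def)
  \<comment> \<open>At most \<open>2 * (N + 1) <= m / 16\<close> of the at least
    \<open>m / 8\<close> elements are in \<open>X\<close>, so at least \<open>m / 16\<close> remain,
    each at least \<open>2 * m\<close>.\<close>
  moreover have "m\<^sup>2 \<le> 8 * \<Sum>E"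
  proof -
    have "card (A \<inter> {2 * m..<4 * m}) - card X \<le> card E"
      unfolding E_def by (rule diff_card_le_card_Diff) (use X in \<open>simp add: sums_run_def\<close>)
    then have "m \<le> 16 * card E"
      using many X by linarith
    then have "m * m \<le> 16 * card E * m"
      by simp
    also have "16 * card E * m = 8 * (card E * (2 * m))"
      by simp
    also have "card E * (2 * m) \<le> \<Sum>E"
      using sum_bounded_below[of E "2 * m" "\<lambda>x. x"] by (auto simp: E_def)
    finally show ?thesis
      by (simp add: power2_eq_square)
  qed
  ultimately show ?thesis
    using X s y by (intro subset_sums_if_sums_run[of "E \<union> X" s "l + \<Sum>E"]) (auto simp: E_def)
qed

section \<open>Pigeonhole arguments for pairs in one of two colours\<close>

lemma card_vimage_add_le:
  fixes F :: "nat set"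
  assumes "finite F"
  shows "finite ((\<lambda>a. a + k) -` F)" "card ((\<lambda>a. a + k) -` F) \<le> card F"
  using assms card_vimage_inj_on_le[of "\<lambda>a. a + k" UNIV F] by (auto intro!: finite_vimageI inj_onI)

text \<open>Among the \<open>m\<close> numbers from \<open>2 * m\<close> on, \<open>a\<close> is bad
  only if \<open>a\<close> or \<open>a + t\<close> lies in \<open>F\<close> or \<open>B\<close>;
  sparseness leaves fewer than \<open>m\<close> bad ones.\<close>

lemma rich_in_pairs_if_sparse_complement:
  assumes cover: "\<And>n. 0 < n \<Longrightarrow> n \<in> A \<or> n \<in> B"
    and sparse: "8 * card (B \<inter> {2 * m..<4 * m}) < m" "32 * (N + 1) \<le> m"
  shows "rich_in_pairs 1 m N A"
  unfolding rich_in_pairs_def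
proof (intro allI impI)
  fix F :: "nat set" and t assume F: "finite F" "card F \<le> 2 * N" and t: "1 \<le> t" "t \<le> m"
  define G where "G = F \<union> B \<inter> {2 * m..<4 * m}"
  define V where "V = G \<union> (\<lambda>a. a + t) -` G"
  have G: "finite G" "card G \<le> 2 * N + card (B \<inter> {2 * m..<4 * m})"
    using F card_Un_le[of F "B \<inter> {2 * m..<4 * m}"] by (auto simp: G_def)
  have V: "finite V" "card V \<le> card G + card G"
    using G card_vimage_add_le[OF G(1), of t] card_Un_le[of G "(\<lambda>a. a + t) -` G"]
    by (auto simp: V_def)
  have "card V < card {2 * m..<3 * m}"
    using V(2) G(2) sparse by simp
  then have "\<not> {2 * m..<3 * m} \<subseteq> V"
    using V(1) card_mono by (metis not_less)
  then obtain a where "a \<in> {2 * m..<3 * m}" "a \<notin> V"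
    by blast
  then show "\<exists>a d. t \<le> d \<and> d \<le> 1 * t \<and> a + d \<le> 7 * m \<and> a \<in> A - F \<and> a + d \<in> A - F"
    using cover[of a] cover[of "a + t"] t
    by (intro exI[of _ a] exI[of _ t]) (auto simp: V_def G_def)
qed

text \<open>If \<open>A\<close> has essentially no pairs at distance \<open>h\<close> and \<open>2 * h\<close>, then almost every \<open>a \<in> A\<close> has
  \<open>a + h\<close> and \<open>a + 2 * h\<close> in \<open>B\<close>. Either \<open>a + h + t\<close> is in \<open>B\<close>, or it is in \<open>A\<close> and then
  \<open>a + 2 * h + t\<close> is in \<open>B\<close>; in both cases \<open>B\<close> has a pair at distance exactly \<open>t\<close>.\<close>

lemma rich_in_pairs_or_complement:
  assumes cover: "\<And>n. 0 < n \<Longrightarrow> n \<in> A \<or> n \<in> B"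
    and many: "m \<le> 8 * card (A \<inter> {2 * m..<4 * m})" "200 * (N + 1) \<le> m"
    and poor: "\<not> rich_in_pairs 2 m N A"
  shows "rich_in_pairs 1 m N B"
  unfolding rich_in_pairs_def
proof (intro allI impI)
  fix F :: "nat set" and t assume F: "finite F" "card F \<le> 2 * N" and t: "1 \<le> t" "t \<le> m"
  obtain F0 h where F0: "finite F0" "card F0 \<le> 2 * N" and h: "1 \<le> h" "h \<le> m"
    and no: "\<And>a d. h \<le> d \<Longrightarrow> d \<le> 2 * h \<Longrightarrow> a + d \<le> 7 * m \<Longrightarrow> a \<in> A - F0 \<Longrightarrow> a + d \<notin> A - F0"
    using poor unfolding rich_in_pairs_def by metis
  define G where "G = F \<union> F0"
  \<comment> \<open>The \<open>a\<close> for which one of the five points of the argument is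
    forbidden: at most \<open>5 * 4 * N\<close>, which is below \<open>m / 8\<close> by
    \<open>200 * (N + 1) <= m\<close>.\<close>
  define V where "V = (\<Union>k\<in>{0, h, 2 * h, h + t, 2 * h + t}. (\<lambda>a. a + k) -` G)"
  have G: "finite G" "card G \<le> 4 * N"
    using F F0 card_Un_le[of F F0] by (auto simp: G_def)
  have "card V \<le> (\<Sum>k\<in>{0, h, 2 * h, h + t, 2 * h + t}. card ((\<lambda>a. a + k) -` G))"
    unfolding V_def by (rule card_UN_le) auto
  also have "\<dots> \<le> card {0, h, 2 * h, h + t, 2 * h + t} * (4 * N)"
    using card_vimage_add_le[OF G(1)] G(2)
    by (intro sum_bounded_above[where K = "4 * N", simplified]) (auto intro: le_trans)
  also have "\<dots> \<le> 5 * (4 * N)"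
    by (intro mult_right_mono) (auto simp: card_insert_if)
  finally have "card V \<le> 20 * N"
    by simp
  then have "card V < card (A \<inter> {2 * m..<4 * m})"
    using many by simp
  moreover have "finite V"
    using G(1) card_vimage_add_le[OF G(1)] by (auto simp: V_def)
  ultimately have "\<not> A \<inter> {2 * m..<4 * m} \<subseteq> V"
    using card_mono by (metis not_less)
  then obtain a where a: "a \<in> A" "2 * m \<le> a" "a < 4 * m" and "a \<notin> V"
    by (auto simp: subset_iff)
  then have notG: "a \<notin> G" "a + h \<notin> G" "a + 2 * h \<notin> G" "a + h + t \<notin> G" "a + 2 * h + t \<notin> G"
    by (auto simp: V_def add.assoc)
  have B: "a + h \<in> B" "a + 2 * h \<in> B"
    using no[of h a] no[of "2 * h" a] a h notG cover[of "a + h"] cover[of "a + 2 * h"]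
    by (auto simp: G_def)
  \<comment> \<open>The bound \<open>7 * m\<close> in \<open>rich_in_pairs\<close> comes from here:
    \<open>4 * m + 2 * m + m\<close>.\<close>
  have le: "a + 2 * h + t \<le> 7 * m"
    using a h t by linarith
  show "\<exists>a d. t \<le> d \<and> d \<le> 1 * t \<and> a + d \<le> 7 * m \<and> a \<in> B - F \<and> a + d \<in> B - F"
  proof (cases "a + h + t \<in> B")
    case True
    then show ?thesis
      using B notG le by (intro exI[of _ "a + h"] exI[of _ t]) (auto simp: G_def)
  next
    case False
    then have "a + h + t \<in> A"
      using cover[of "a + h + t"] h by auto
    moreover have shift: "a + h + t + h = a + 2 * h + t"
      by simp
    ultimately have "a + 2 * h + t \<notin> A - F0"
      using no[of h "a + h + t", unfolded shift] notG le by (simp add: G_def)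
    then have "a + 2 * h + t \<in> B"
      using notG h cover[of "a + 2 * h + t"] by (auto simp: G_def)
    then show ?thesis
      using B notG le by (intro exI[of _ "a + 2 * h"] exI[of _ t]) (auto simp: G_def)
  qed
qed

text \<open>Since 1 gives \<open>A\<close> its two starting sums, \<open>A\<close> only needs
  differences up to a factor 2. If it lacks them or is sparse, \<open>B\<close> has all exact
  differences, among them 1; a sparse \<open>B\<close> hands exact differences to
  \<open>A\<close>.\<close>

lemma subset_sums_dichotomy_aux:
  assumes cover: "\<And>n. 0 < n \<Longrightarrow> n \<in> A \<or> n \<in> B"
    and "1 \<in> A" and N: "4 * real m \<le> (5 / 4) ^ N" "200 * (N + 1) \<le> m"
  defines "I \<equiv> {y. 7 * m * (N + 1) \<le> y \<and> 8 * y \<le> m\<^sup>2}"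
  shows "I \<subseteq> subset_sums A \<or> I \<subseteq> subset_sums B"
proof -
  have cover': "n \<in> B \<or> n \<in> A" if "0 < n" for n
    using cover that by blast
  have win: "I \<subseteq> subset_sums C"
    if "rich_in_pairs 2 m N C" "1 \<in> C \<or> rich_in_pairs 1 m N C"
      "m \<le> 8 * card (C \<inter> {2 * m..<4 * m})" for C
    using subset_sums_if_rich_in_pairs[of m N C] that N by (auto simp: I_def)
  have half: "2 * m \<le> card (A \<inter> {2 * m..<4 * m}) + card (B \<inter> {2 * m..<4 * m})"
  proof -
    have "card {2 * m..<4 * m} \<le> card (A \<inter> {2 * m..<4 * m} \<union> B \<inter> {2 * m..<4 * m})"
    proof (intro card_mono subsetI)
      fix n assume "n \<in> {2 * m..<4 * m}"
      moreover have "0 < n"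
        using calculation N by simp
      ultimately show "n \<in> A \<inter> {2 * m..<4 * m} \<union> B \<inter> {2 * m..<4 * m}"
        using cover[of n] by blast
    qed simp
    then show ?thesis
      using card_Un_le[of "A \<inter> {2 * m..<4 * m}" "B \<inter> {2 * m..<4 * m}"] by simp
  qed
  consider "8 * card (A \<inter> {2 * m..<4 * m}) < m" | "8 * card (B \<inter> {2 * m..<4 * m}) < m"
    | "m \<le> 8 * card (A \<inter> {2 * m..<4 * m})" "m \<le> 8 * card (B \<inter> {2 * m..<4 * m})"
    by linarith
  then show ?thesis
  proof cases
    case 1
    have "rich_in_pairs 1 m N B"
      by (rule rich_in_pairs_if_sparse_complement[OF cover' 1]) (use N in simp_all)
    then show ?thesis
      using win[of B] rich_in_pairs_mono[of 1 m N B 2] 1 half by auto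
  next
    case 2
    have "rich_in_pairs 1 m N A"
      by (rule rich_in_pairs_if_sparse_complement[OF cover 2]) (use N in simp_all)
    then show ?thesis
      using win[of A] rich_in_pairs_mono[of 1 m N A 2] 2 half by auto
  next
    case 3
    show ?thesis
    proof (cases "rich_in_pairs 2 m N A")
      case True
      then show ?thesis
        using win[of A] 3 \<open>1 \<in> A\<close> by auto
    next
      case False
      then have "rich_in_pairs 1 m N B"
        using rich_in_pairs_or_complement[OF cover 3(1) N(2)] by simp
      then show ?thesis
        using win[of B] rich_in_pairs_mono[of 1 m N B 2] 3 by auto
    qed
  qed
qed

lemma subset_sums_dichotomy:
  assumes cover: "\<And>n. 0 < n \<Longrightarrow> n \<in> A \<or> n \<in> B"
    and N: "4 * real m \<le> (5 / 4) ^ N" "200 * (N + 1) \<le> m"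
  defines "I \<equiv> {y. 7 * m * (N + 1) \<le> y \<and> 8 * y \<le> m\<^sup>2}"
  shows "I \<subseteq> subset_sums A \<or> I \<subseteq> subset_sums B"
proof (cases "1 \<in> A")
  case True
  then show ?thesis
    using subset_sums_dichotomy_aux[OF cover True N] by (simp add: I_def)
next
  case False
  then have "1 \<in> B"
    using cover[of 1] by auto
  then show ?thesis
    using subset_sums_dichotomy_aux[of B A, OF _ \<open>1 \<in> B\<close> N] cover by (auto simp: I_def)
qed

subsection \<open>Missing sums of two colours are far apart\<close>

text \<open>Apply the dichotomy with \<open>m\<close> about \<open>sqrt (8 * y)\<close> and
  \<open>N\<close> about \<open>log (5 / 4) (4 * m)\<close>. The interval then reaches
  \<open>y\<close> and starts at \<open>sqrt y\<close> up to a logarithmic factor, hence below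
  \<open>y powr \<mu>\<close>. An \<open>x\<close> above that start would make \<open>x\<close> and
  \<open>y\<close> sums of one colour.\<close>

lemma missing_sums_far_apart:
  assumes cover: "\<And>n. 0 < n \<Longrightarrow> n \<in> A \<or> n \<in> B" and \<mu>: "1 / 2 < \<mu>"
  shows "\<exists>Y. \<forall>x y. Y \<le> real y \<and> x \<le> y \<and> x \<notin> subset_sums A \<and> y \<notin> subset_sums B \<longrightarrow>
           real x < real y powr \<mu>"
proof -
  define m where "m y = sqrt (8 * y) + 1" for y :: real
  define n where "n y = log (5 / 4) (4 * m y) + 1" for y :: real
  have "\<forall>\<^sub>F y in at_top. 7 * m y * (n y + 1) < y powr \<mu>"
    using \<mu> unfolding m_def n_def by real_asymp
  moreover have "\<forall>\<^sub>F y in at_top. 200 * (n y + 1) \<le> m y - 1"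
    unfolding m_def n_def by real_asymp
  moreover have "\<forall>\<^sub>F y in at_top. 1 \<le> (y::real)"
    by (rule eventually_ge_at_top)
  ultimately have "\<forall>\<^sub>F y in at_top. 7 * m y * (n y + 1) < y powr \<mu> \<and>
      200 * (n y + 1) \<le> m y - 1 \<and> 1 \<le> y"
    by eventually_elim simp
  then obtain Y0 where Y0: "\<And>y. Y0 \<le> y \<Longrightarrow> 7 * m y * (n y + 1) < y powr \<mu> \<and>
      200 * (n y + 1) \<le> m y - 1 \<and> 1 \<le> y"
    unfolding eventually_at_top_linorder by auto
  show ?thesis
  proof (intro exI[of _ Y0] allI impI; rule ccontr)
    fix x y
    assume xy: "Y0 \<le> real y \<and> x \<le> y \<and> x \<notin> subset_sums A \<and> y \<notin> subset_sums B"
      and "\<not> real x < real y powr \<mu>"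
    then have big: "7 * m y * (n y + 1) < real x" and big': "200 * (n y + 1) \<le> m y - 1"
      and y1: "1 \<le> real y"
      using Y0[of "real y"] by auto
    define k where "k = nat \<lceil>sqrt (8 * real y)\<rceil>"
    define N where "N = nat \<lceil>log (5 / 4) (4 * m y)\<rceil>"
    have k: "sqrt (8 * real y) \<le> real k" "real k \<le> m y"
      by (auto simp: k_def m_def)
    have m: "1 \<le> m y"
      by (simp add: m_def)
    then have "0 \<le> log (5 / 4) (4 * m y)"
      by (subst zero_le_log_cancel_iff) auto
    then have N: "log (5 / 4) (4 * m y) \<le> real N" "real N \<le> n y"
      by (auto simp: N_def n_def)
    have "4 * m y \<le> (5 / 4) powr real N"
      using N(1) m by (subst log_le_iff[symmetric]) auto
    then have N1: "4 * real k \<le> (5 / 4) ^ N"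
      using k by (simp add: powr_realpow)
    have "real (200 * (N + 1)) \<le> 200 * (n y + 1)"
      using N by simp
    also have "\<dots> \<le> real k"
      using big' k by (simp add: m_def)
    finally have N2: "200 * (N + 1) \<le> k"
      by linarith
    have "7 * real k * (real N + 1) \<le> 7 * m y * (n y + 1)"
      using N(2) k m by (intro mult_mono) auto
    then have "real (7 * k * (N + 1)) \<le> 7 * m y * (n y + 1)"
      by (simp add: algebra_simps)
    then have low: "7 * k * (N + 1) \<le> x"
      using big by linarith
    have "8 * real y \<le> (real k)\<^sup>2"
      using k(1) y1 by (simp add: real_le_rsqrt sqrt_le_D)
    then have "real (8 * y) \<le> real (k\<^sup>2)"
      by simp
    then have high: "8 * y \<le> k\<^sup>2"
      by (simp only: of_nat_le_iff)
    from subset_sums_dichotomy[OF cover N1 N2] show False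
      using xy low high by (auto simp: subset_iff dest: le_trans[of "8 * x" "8 * y"])
  qed
qed

section \<open>Logarithmic mass of intervals, and the recurrence for two sparse sets\<close>

lemma sum_inverse_nat_le:
  assumes "1 \<le> p" "p \<le> q"
  shows "(\<Sum>n\<in>{p..q}. 1 / real n) \<le> 1 + ln (real q) - ln (real p)"
  using assms(2)
proof (induction q rule: dec_induct)
  case base
  show ?case
    using assms by simp
next
  case (step q)
  have "ln (real q / real (Suc q)) \<le> real q / real (Suc q) - 1"
    using step assms by (intro ln_le_minus_one) auto
  also have "\<dots> = - (1 / real (Suc q))"
    by (simp add: field_simps)
  finally have "1 / real (Suc q) \<le> ln (real (Suc q)) - ln (real q)"
    using step assms by (simp add: ln_div)
  moreover have "{p..Suc q} = insert (Suc q) {p..q}"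
    using step by auto
  ultimately show ?case
    using step by simp
qed

lemma ln_le_iff:
  assumes "0 < x"
  shows "ln x \<le> b \<longleftrightarrow> x \<le> exp (b::real)"
  using ln_le_cancel_iff[of x "exp b"] assms by simp

text \<open>Comparison with the integral of \<open>1 / x\<close>; the summand 1 pays for the first
  integer. Both density bounds measure sets through this estimate.\<close>

lemma sum_inverse_le_if_ln_bounds:
  assumes "\<And>n. n \<in> E \<Longrightarrow> 0 < n \<and> a \<le> ln (real n) \<and> ln (real n) \<le> b" and "a \<le> b"
  shows "finite E" "(\<Sum>n\<in>E. 1 / real n) \<le> 1 + b - a"
proof -
  define p where "p = nat \<lceil>max 1 (exp a)\<rceil>"
  define q where "q = nat \<lfloor>exp b\<rfloor>"
  have bounds: "p \<le> n \<and> n \<le> q" if "n \<in> E" for n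
  proof -
    have "exp a \<le> real n" "real n \<le> exp b"
      using assms(1)[OF that] by (auto simp: ln_ge_iff ln_le_iff)
    moreover have "1 \<le> real n"
      using assms(1)[OF that] by simp
    ultimately show ?thesis
      by (auto simp: p_def q_def le_nat_floor nat_ceiling_le_eq)
  qed
  then have sub: "E \<subseteq> {p..q}"
    by auto
  then show "finite E"
    by (rule finite_subset) simp
  have p: "1 \<le> p" "exp a \<le> real p"
    by (auto simp: p_def) linarith+
  show "(\<Sum>n\<in>E. 1 / real n) \<le> 1 + b - a"
  proof (cases "p \<le> q")
    case True
    have "(\<Sum>n\<in>E. 1 / real n) \<le> (\<Sum>n\<in>{p..q}. 1 / real n)"
      using sub by (intro sum_mono2) auto
    also have "\<dots> \<le> 1 + ln (real q) - ln (real p)"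
      using p True by (intro sum_inverse_nat_le) auto
    finally have "(\<Sum>n\<in>E. 1 / real n) \<le> 1 + ln (real q) - ln (real p)" .
    moreover have "ln (real q) \<le> b"
    proof -
      have "real q \<le> exp b"
        by (simp add: q_def)
      then show ?thesis
        using p True by (simp add: ln_le_iff)
    qed
    moreover have "a \<le> ln (real p)"
      using p by (simp add: ln_ge_iff)
    ultimately show ?thesis
      by simp
  next
    case False
    then have "E = {}"
      using sub by auto
    then show ?thesis
      using assms(2) by simp
  qed
qed

text \<open>The ratios satisfy \<open>c * t (k + 1) * t k <= \<mu> * t k - (1 - c)\<close>. By the
  inequality of means, \<open>c * t k * t k + (1 - c) >= s * t k\<close> with
  \<open>s > \<mu>\<close>, so the ratio falls by the fixed \<open>\<delta>\<close> at each step and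
  cannot stay positive.\<close>

lemma no_positive_recurrence:
  fixes P :: "nat \<Rightarrow> real"
  assumes pos: "\<And>k. k0 \<le> k \<Longrightarrow> 0 < P k" and c: "0 < c" "c < 1" "0 \<le> \<mu>" "\<mu>\<^sup>2 < 4 * c * (1 - c)"
    and rec: "\<And>k. k0 \<le> k \<Longrightarrow> c * (P (k + 2) - P k) \<le> \<mu> * P (k + 1) - P k"
  shows False
proof -
  define s where "s = sqrt (4 * c * (1 - c))"
  define \<delta> where "\<delta> = (s - \<mu>) / c"
  define t where "t k = P (k + 1) / P k" for k
  have s2: "s\<^sup>2 = 4 * c * (1 - c)"
    using c by (simp add: s_def)
  have "\<mu> < s"
    unfolding s_def using c by (intro real_less_rsqrt) auto
  then have "0 < \<delta>"
    using c by (simp add: \<delta>_def)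
  have t_pos: "0 < t k" if "k0 \<le> k" for k
    using pos that by (simp add: t_def)
  have step: "t (k + 1) \<le> t k - \<delta>" if k: "k0 \<le> k" for k
  proof -
    have P: "P (k + 1) = t k * P k" "P (k + 2) = t (k + 1) * t k * P k"
      using pos[of k] pos[of "k + 1"] k by (auto simp: t_def)
    have "c * t (k + 1) * t k * P k \<le> (\<mu> * t k - (1 - c)) * P k"
      using rec[OF k] unfolding P by (simp add: algebra_simps)
    then have 1: "c * t (k + 1) * t k \<le> \<mu> * t k - (1 - c)"
      using pos[OF k] by simp
    have "0 \<le> (2 * c * t k - s)\<^sup>2"
      by simp
    also have "\<dots> = 4 * c * (c * t k * t k + (1 - c) - s * t k)"
      using s2 by (simp add: power2_eq_square algebra_simps)
    finally have "s * t k \<le> c * t k * t k + (1 - c)"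
      using c by (simp add: zero_le_mult_iff)
    then have "c * t (k + 1) * t k \<le> (\<mu> + c * t k - s) * t k"
      using 1 by (simp add: algebra_simps)
    then have "c * t (k + 1) \<le> \<mu> + c * t k - s"
      using t_pos[OF k] by simp
    then show ?thesis
      using c by (simp add: \<delta>_def field_simps)
  qed
  have "t (k0 + j) \<le> t k0 - real j * \<delta>" for j
  proof (induction j)
    case (Suc j)
    then show ?case
      using step[of "k0 + j"] by (simp add: algebra_simps)
  qed simp
  moreover obtain j :: nat where "t k0 / \<delta> < real j"
    using reals_Archimedean2 by blast
  ultimately show False
    using t_pos[of "k0 + j"] \<open>0 < \<delta>\<close> by (simp add: field_simps) (smt (verit))
qed

text \<open>No signs alternate: the sum runs over the indices up to \<open>k\<close> of the same
  parity as \<open>k\<close>.\<close>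

fun alternating_sum :: "(nat \<Rightarrow> real) \<Rightarrow> nat \<Rightarrow> real" where
  "alternating_sum L 0 = L 0"
| "alternating_sum L (Suc 0) = L 1"
| "alternating_sum L (Suc (Suc k)) = alternating_sum L k + L (k + 2)"

lemma le_alternating_sum:
  assumes "\<And>k. 0 \<le> L k"
  shows "L k \<le> alternating_sum L k"
  using assms
proof (induction L k rule: alternating_sum.induct)
  case (3 L k)
  have "0 \<le> alternating_sum L k"
    using 3(1)[OF 3(2)] 3(2)[of k] by linarith
  then show ?case
    by simp
qed auto

text \<open>The sets \<open>T k\<close> alternate between two sets, and \<open>p\<close> enumerates the points where an enumeration
  of their union switches from one to the other. Since \<open>T k\<close> has no elements between
  \<open>p (k + 1) powr \<mu>\<close> and \<open>p (k + 2)\<close>, its logarithmic mass up to \<open>p (k + 2)\<close> is bounded in terms of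
  the logarithms of the points \<open>p j\<close>.\<close>

lemma far_apart_sets_not_both_dense:
  fixes T :: "nat \<Rightarrow> nat set" and c \<mu> :: real
  assumes period: "\<And>k. T (k + 2) = T k" and pos: "\<And>k n. n \<in> T k \<Longrightarrow> 0 < n"
    and c: "0 < c" "c < 1 / 2" and \<mu>: "0 < \<mu>" "\<mu> < 1" "\<mu>\<^sup>2 < 4 * c * (1 - c)"
    and dense: "\<And>k x. x0 \<le> x \<Longrightarrow> c * ln (real x) \<le> (\<Sum>n | n \<in> T k \<and> n \<le> x. 1 / real n)"
    and apart: "\<And>k x y. x0 \<le> x \<Longrightarrow> x \<le> y \<Longrightarrow> x \<in> T k \<Longrightarrow> y \<in> T (k + 1) \<Longrightarrow>
                  ln (real x) \<le> \<mu> * ln (real y)"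
  shows False
proof -
  have unbounded: "\<exists>n>x. n \<in> T k" for x k
  proof (rule ccontr)
    assume "\<not> ?thesis"
    then have T: "{n. n \<in> T k \<and> n \<le> y} \<subseteq> {..x}" for y
      by (auto simp: not_less)
    define M where "M = (\<Sum>n\<le>x. 1 / real n)"
    have "\<forall>\<^sub>F y :: real in at_top. M < c * ln y"
      using c by real_asymp
    then have "\<forall>\<^sub>F y :: nat in at_top. M < c * ln (real y)"
      by (rule eventually_compose_filterlim[OF _ filterlim_real_sequentially])
    then have "\<forall>\<^sub>F y in at_top. M < c * ln (real y) \<and> x0 \<le> y"
      using eventually_ge_at_top[of x0] by eventually_elim simp
    then obtain y where y: "M < c * ln (real y)" "x0 \<le> y"
      unfolding eventually_sequentially by blast
    have "(\<Sum>n | n \<in> T k \<and> n \<le> y. 1 / real n) \<le> M"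
      unfolding M_def using T by (intro sum_mono2) auto
    then show False
      using dense[OF y(2), of k] y(1) by simp
  qed
  define x1 where "x1 = max x0 2"
  define p where "p = rec_nat (LEAST n. x1 < n \<and> n \<in> T 0) (\<lambda>k q. LEAST n. q < n \<and> n \<in> T (Suc k))"
  have p0: "x1 < p 0 \<and> p 0 \<in> T 0"
    unfolding p_def using LeastI_ex[OF unbounded[of x1 0]] by simp
  have p_Suc: "p k < p (Suc k) \<and> p (Suc k) \<in> T (Suc k)" for k
    unfolding p_def using LeastI_ex[OF unbounded[of _ "Suc k"]] by simp
  have p_least: "p (Suc k) \<le> n" if "p k < n" "n \<in> T (Suc k)" for k n
    unfolding p_def using that by (simp add: p_def Least_le)
  have p_T: "p k \<in> T k" for k
    using p0 p_Suc by (cases k) auto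
  have p_gt: "x1 < p k" for k
    using p0 p_Suc by (induction k) (auto intro: less_trans)
  define L where "L k = ln (real (p k))" for k
  have L_pos: "0 < L k" for k
    using p_gt[of k] by (simp add: L_def x1_def)
  have L_growth: "L k \<le> \<mu> * L (k + 1)" for k
    unfolding L_def using p_gt[of k] p_T[of k] p_T[of "Suc k"] p_Suc[of k]
    by (intro apart[of _ _ k]) (auto simp: x1_def)
  define Q where "Q k = (\<Sum>n | n \<in> T k \<and> n \<le> p k. 1 / real n)" for k
  have Q_ge: "c * L k \<le> Q k" for k
    unfolding Q_def L_def using p_gt[of k] by (intro dense) (auto simp: x1_def)
  have Q_step: "Q (k + 2) \<le> Q k + (\<mu> * L (k + 1) - L k) + 2" for k
  proof -
    define E where "E = {n \<in> T k. p k < n \<and> n \<le> p (k + 1)}"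
    have E: "0 < n \<and> L k \<le> ln (real n) \<and> ln (real n) \<le> \<mu> * L (k + 1)" if "n \<in> E" for n
    proof -
      have "ln (real n) \<le> \<mu> * L (k + 1)"
        unfolding L_def using that p_gt[of k] p_T[of "k + 1"]
        by (intro apart[of _ _ k]) (auto simp: E_def x1_def)
      moreover have "L k \<le> ln (real n)"
        unfolding L_def using that p_gt[of k] by (simp add: E_def)
      ultimately show ?thesis
        using that by (auto simp: E_def)
    qed
    have sum_E: "finite E" "(\<Sum>n\<in>E. 1 / real n) \<le> 1 + \<mu> * L (k + 1) - L k"
      using sum_inverse_le_if_ln_bounds[of E "L k" "\<mu> * L (k + 1)"] E L_growth by auto
    \<comment> \<open>Past \<open>p (k + 1)\<close> the first element of \<open>T k\<close> is
      \<open>p (k + 2)\<close>. This single term and the 1 in the bound for \<open>E\<close> make up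
      the 2.\<close>
    have "Q (k + 2) \<le> (\<Sum>n\<in>insert (p (k + 2)) ({n. n \<in> T k \<and> n \<le> p k} \<union> E). 1 / real n)"
      unfolding Q_def
    proof (intro sum_mono2)
      show "{n. n \<in> T (k + 2) \<and> n \<le> p (k + 2)} \<subseteq>
          insert (p (k + 2)) ({n. n \<in> T k \<and> n \<le> p k} \<union> E)"
        using p_least[of "k + 1"] period[of k] by (force simp: E_def not_le)
    qed (use sum_E in auto)
    also have "\<dots> \<le> 1 / real (p (k + 2)) + (\<Sum>n\<in>{n. n \<in> T k \<and> n \<le> p k} \<union> E. 1 / real n)"
      using sum_E by (subst sum.insert_if) auto
    also have "(\<Sum>n\<in>{n. n \<in> T k \<and> n \<le> p k} \<union> E. 1 / real n) = Q k + (\<Sum>n\<in>E. 1 / real n)"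
      unfolding Q_def using sum_E by (intro sum.union_disjoint) (auto simp: E_def)
    also have "1 / real (p (k + 2)) \<le> 1"
      using p_gt[of "k + 2"] by simp
    finally show ?thesis
      using sum_E by simp
  qed
  define P where "P = alternating_sum L"
  have P_Suc_Suc: "P (k + 2) = P k + L (k + 2)" for k
    by (simp add: P_def)
  have P_ge: "L k \<le> P k" for k
    unfolding P_def using L_pos by (intro le_alternating_sum) (simp add: less_imp_le)
  have P_pos: "0 < P k" for k
    using L_pos P_ge by (rule less_le_trans)
  define C where "C = Q 0 + Q 1 + 2"
  have Q_nonneg: "0 \<le> Q k" for k
    by (auto simp: Q_def intro: sum_nonneg)
  \<comment> \<open>Telescoping \<open>Q_step\<close> in steps of two collects the positive
    logarithms in \<open>P (k + 1)\<close> and the negative ones in \<open>P k\<close>;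
    \<open>C\<close> covers the base cases.\<close>
  have Q_le: "Q (k + 2) \<le> C + 2 * real k + \<mu> * P (k + 1) - P k" for k
  proof (induction k rule: nat_less_induct)
    case (1 k)
    consider "k = 0" | "k = 1" | j where "k = j + 2"
      by (metis One_nat_def Suc_eq_plus1 add_2_eq_Suc' not0_implies_Suc)
    then show ?case
    proof cases
      case 1
      then show ?thesis
        using Q_step[of 0] Q_nonneg[of 1] by (simp add: C_def P_def)
    next
      case 2
      have "\<mu> * L 2 \<le> \<mu> * P 2"
        using P_ge \<mu> by simp
      then show ?thesis
        using 2 Q_step[of 1] Q_nonneg[of 0] by (simp add: C_def P_def numeral_2_eq_2 numeral_3_eq_3)
    next
      case 3
      then have "Q (j + 2) \<le> C + 2 * real j + \<mu> * P (j + 1) - P j"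
        using 1 by simp
      moreover have "Q (j + 2 + 2) \<le> Q (j + 2) + (\<mu> * L (j + 2 + 1) - L (j + 2)) + 2"
        by (rule Q_step)
      moreover have "P (Suc (Suc (Suc j))) = P (Suc j) + L (Suc (Suc (Suc j)))"
        by (simp add: P_def)
      ultimately show ?thesis
        using 3 P_Suc_Suc[of j] by (simp add: algebra_simps)
    qed
  qed
  have L_exp: "L 0 * (1 / \<mu>) ^ k \<le> L k" for k
  proof (induction k)
    case (Suc k)
    have "L 0 * (1 / \<mu>) ^ Suc k \<le> L k / \<mu>"
      using Suc \<mu> by (simp add: divide_right_mono)
    also have "\<dots> \<le> L (Suc k)"
      using L_growth[of k] \<mu> by (simp add: field_simps)
    finally show ?case .
  qed simp
  \<comment> \<open>Lowering \<open>c\<close> slightly frees \<open>(c - c') * L (k + 2)\<close>,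
    which grows geometrically and absorbs the linear error \<open>C + 2 * k\<close>.\<close>
  have "\<exists>c'. 0 < c' \<and> c' < c \<and> \<mu>\<^sup>2 < 4 * c' * (1 - c')"
  proof -
    have "((\<lambda>x. 4 * x * (1 - x)) \<longlongrightarrow> 4 * c * (1 - c)) (at_left c)"
      by (intro tendsto_intros)
    then have "\<forall>\<^sub>F x in at_left c. \<mu>\<^sup>2 < 4 * x * (1 - x)"
      using \<mu> order_tendstoD(1) by blast
    then have "\<forall>\<^sub>F x in at_left c. 0 < x \<and> x < c \<and> \<mu>\<^sup>2 < 4 * x * (1 - x)"
      using eventually_at_left_real[OF c(1)] by eventually_elim auto
    then show ?thesis
      using eventually_happens trivial_limit_at_left_real by blast
  qed
  then obtain c' where c': "0 < c'" "c' < c" "\<mu>\<^sup>2 < 4 * c' * (1 - c')"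
    by blast
  have "\<forall>\<^sub>F k :: nat in at_top. C + 2 * real k \<le> (c - c') * (L 0 * (1 / \<mu>) ^ (k + 2))"
  proof -
    define q where "q = 1 / \<mu>"
    have "1 < q" "0 < c - c'" "0 < L 0"
      using \<mu> c' L_pos by (auto simp: q_def)
    then show ?thesis
      unfolding q_def[symmetric] by real_asymp
  qed
  then obtain k0 where k0: "\<And>k. k0 \<le> k \<Longrightarrow> C + 2 * real k \<le> (c - c') * (L 0 * (1 / \<mu>) ^ (k + 2))"
    unfolding eventually_at_top_linorder by auto
  show False
  proof (rule no_positive_recurrence[of k0 P c' \<mu>])
    fix k assume "k0 \<le> k"
    then have "C + 2 * real k \<le> (c - c') * (L 0 * (1 / \<mu>) ^ (k + 2))"
      by (rule k0)
    also have "\<dots> \<le> (c - c') * L (k + 2)"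
      using L_exp[of "k + 2"] c' by (intro mult_left_mono) (simp_all only: diff_ge_0_iff_ge less_imp_le)
    finally show "c' * (P (k + 2) - P k) \<le> \<mu> * P (k + 1) - P k"
      using Q_le[of k] Q_ge[of "k + 2"] P_Suc_Suc[of k] by (simp add: algebra_simps)
  qed (use P_pos c c' \<mu> in auto)
qed

subsection \<open>Two colours: the lower bound\<close>

lemma two_colour_lower_bound:
  assumes cover: "\<And>n. 0 < n \<Longrightarrow> n \<in> A \<or> n \<in> B"
  shows "ereal ((2 + sqrt 3) / 4) \<le>
    max (upper_log_density (subset_sums A)) (upper_log_density (subset_sums B))"
proof (rule ccontr)
  assume "\<not> ?thesis"
  then have "max (upper_log_density (subset_sums A)) (upper_log_density (subset_sums B))
      < ereal ((2 + sqrt 3) / 4)"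
    by (simp add: not_le)
  then obtain z where z: "upper_log_density (subset_sums A) < ereal z"
      "upper_log_density (subset_sums B) < ereal z" "z < (2 + sqrt 3) / 4"
    using ereal_dense2 by (metis ereal_less_eq(3) less_ereal.simps(1) max_less_iff_conj)
  \<comment> \<open>The choice of \<open>z\<close> puts \<open>c\<close> above
    \<open>(2 - sqrt 3) / 4\<close>; the maximum with 3/4 keeps it below 1/2.\<close>
  define c where "c = 1 - max z (3 / 4)"
  have sqrt3: "1 < sqrt (3::real)" "sqrt (3::real) < 2"
    by (auto simp: real_less_lsqrt)
  have c: "0 < c" "c < 1 / 2"
    using z(3) sqrt3 by (auto simp: c_def)
  \<comment> \<open>As \<open>4 * c * (1 - c) = 1 - (1 - 2 * c)^2\<close>, equality would hold at
    \<open>c = (2 - sqrt 3) / 4\<close>: the source of the constant.\<close>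
  have c_gt: "1 / 4 < 4 * c * (1 - c)"
  proof -
    have "1 - 2 * c < sqrt 3 / 2"
      using z(3) sqrt3 real_less_rsqrt[of "3 / 2" 3] by (auto simp: c_def max_def power2_eq_square)
    then have "(1 - 2 * c)\<^sup>2 < (sqrt 3 / 2)\<^sup>2"
      using c by (intro power_strict_mono) auto
    then show ?thesis
      by (simp add: power2_eq_square algebra_simps)
  qed
  \<comment> \<open>Above 1/2 for the separation of missing sums, yet small enough for a negative
    discriminant in the recurrence.\<close>
  obtain \<mu> where \<mu>: "1 / 2 < \<mu>" "\<mu> < 1" "\<mu>\<^sup>2 < 4 * c * (1 - c)"
  proof -
    have "1 / 2 < sqrt (4 * c * (1 - c))"
      using c_gt by (intro real_less_rsqrt) (simp add: power2_eq_square)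
    then obtain \<mu> where "1 / 2 < \<mu>" "\<mu> < min 1 (sqrt (4 * c * (1 - c)))"
      using dense[of "1 / 2" "min 1 (sqrt (4 * c * (1 - c)))"] by auto
    moreover from this have "\<mu>\<^sup>2 < (sqrt (4 * c * (1 - c)))\<^sup>2"
      by (intro power_strict_mono) auto
    ultimately show ?thesis
      using that c by simp
  qed
  define S where "S k = subset_sums (if even k then A else B)" for k :: nat
  define T where "T k = {n. 0 < n \<and> n \<notin> S k}" for k
  have "\<forall>\<^sub>F x in at_top. log_density (S k) x < 1 - c" for k
  proof -
    have "upper_log_density (S k) < ereal (1 - c)"
      using z by (auto simp: S_def c_def intro: less_le_trans)
    then show ?thesis
      unfolding upper_log_density_def using Limsup_lessD by fastforce
  qed
  then have "\<forall>\<^sub>F x in at_top. log_density (S 0) x < 1 - c \<and> log_density (S 1) x < 1 - c"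
    by (simp add: eventually_conj)
  then obtain x1 where
    "\<And>x. x1 \<le> x \<Longrightarrow> log_density (S 0) x < 1 - c \<and> log_density (S 1) x < 1 - c"
    unfolding eventually_at_top_linorder by blast
  moreover have "S k = S 0 \<or> S k = S 1" for k
    by (simp add: S_def)
  ultimately have x1: "log_density (S k) x < 1 - c" if "x1 \<le> x" for k x
    using that by metis
  obtain Y where Y: "\<And>k x y. Y \<le> real y \<Longrightarrow> x \<le> y \<Longrightarrow> x \<notin> S k \<Longrightarrow> y \<notin> S (k + 1) \<Longrightarrow>
      real x < real y powr \<mu>"
  proof -
    obtain YA where "\<And>x y. YA \<le> real y \<Longrightarrow> x \<le> y \<Longrightarrow> x \<notin> subset_sums A \<Longrightarrow> y \<notin> subset_sums B \<Longrightarrow>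
        real x < real y powr \<mu>"
      using missing_sums_far_apart[OF cover \<mu>(1)] by auto
    moreover have cover': "n \<in> B \<or> n \<in> A" if "0 < n" for n
      using cover that by blast
    obtain YB where "\<And>x y. YB \<le> real y \<Longrightarrow> x \<le> y \<Longrightarrow> x \<notin> subset_sums B \<Longrightarrow> y \<notin> subset_sums A \<Longrightarrow>
        real x < real y powr \<mu>"
      using missing_sums_far_apart[OF cover' \<mu>(1)] by auto
    ultimately show ?thesis
      by (intro that[of "max YA YB"]) (auto simp: S_def split: if_splits)
  qed
  define x0 where "x0 = nat \<lceil>max 2 (max x1 Y)\<rceil>"
  have x0: "2 \<le> real x" "x1 \<le> real x" "Y \<le> real x" if "x0 \<le> x" for x
    using that by (auto simp: x0_def nat_le_iff ceiling_le_iff)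
  show False
  proof (rule far_apart_sets_not_both_dense[of T c \<mu> x0])
    show "c * ln (real x) \<le> (\<Sum>n | n \<in> T k \<and> n \<le> x. 1 / real n)" if "x0 \<le> x" for k x
    proof -
      have ln_pos: "0 < ln (real x)"
        using x0[OF that] by simp
      have "(\<Sum>n | n \<in> S k \<and> 0 < n \<and> real n \<le> real x. 1 / real n) \<le> (1 - c) * ln (real x)"
        using x1[OF x0(2)[OF that], of k] ln_pos by (simp add: log_density_def field_simps)
      moreover have "ln (real x) \<le> (\<Sum>n=1..x. 1 / real n)"
      proof -
        have "ln (real x) \<le> ln (real x + 1)"
          using x0[OF that] by simp
        also have "\<dots> \<le> (\<Sum>n=1..x. 1 / real n)"
          using ln_le_harm[of x] by (simp add: harm_def inverse_eq_divide)
        finally show ?thesis .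
      qed
      moreover have "(\<Sum>n=1..x. 1 / real n) = (\<Sum>n | n \<in> S k \<and> 0 < n \<and> real n \<le> real x. 1 / real n)
          + (\<Sum>n | n \<in> T k \<and> n \<le> x. 1 / real n)"
        by (subst sum.union_disjoint[symmetric])
           (auto simp: T_def intro!: sum.cong finite_subset[of _ "{..x}"])
      ultimately show ?thesis
        by (simp add: algebra_simps)
    qed
    show "ln (real x) \<le> \<mu> * ln (real y)"
      if "x0 \<le> x" "x \<le> y" "x \<in> T k" "y \<in> T (k + 1)" for k x y
    proof -
      have "real x < real y powr \<mu>"
        using Y[of y x k] x0(3)[of y] that by (auto simp: T_def)
      then have "ln (real x) < ln (real y powr \<mu>)"
        using x0[OF that(1)] that(2) by (subst ln_less_cancel_iff) auto
      then show ?thesis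
        using x0(1)[of y] that by (simp add: ln_powr)
    qed
  qed (use c \<mu> in \<open>auto simp: T_def S_def\<close>)
qed

lemma partition_2_lower_bound:
  assumes "partition_of_positives 2 A"
  shows "\<exists>i\<in>{1, 2}. ereal ((2 + sqrt 3) / 4) \<le> upper_log_density (subset_sums (A i))"
proof -
  have "{1..2} = {1, 2 :: nat}"
    by auto
  then have "A 1 \<union> A 2 = {n. 0 < n}"
    using assms by (simp add: partition_of_positives_def)
  then have "n \<in> A 1 \<or> n \<in> A 2" if "0 < n" for n
    using that by blast
  from two_colour_lower_bound[OF this] show ?thesis
    by (auto simp: le_max_iff_disj)
qed

lemma c_min_2_ge: "ereal ((2 + sqrt 3) / 4) \<le> c_min 2"
  unfolding c_min_def
proof (rule Inf_greatest, clarify)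
  fix A assume "partition_of_positives 2 A"
  then show "ereal ((2 + sqrt 3) / 4) \<le> max_density 2 A"
    using partition_2_lower_bound[of A] by (auto simp: max_density_def Max_ge_iff)
qed

subsection \<open>Double exponential blocks: the upper bound\<close>

lemma is_b0_geometric:
  assumes "is_b0 r b" "0 < r"
  shows "(\<Sum>i<r. b ^ i) = 2 * real r + real r / (b - 1)"
proof -
  have "(\<Sum>i<r. b ^ i) = (b ^ r - 1) / (b - 1)"
    using assms by (simp add: geometric_sum is_b0_def)
  also have "b ^ r - 1 = 2 * real r * (b - 1) + real r"
    using assms by (simp add: is_b0_def algebra_simps)
  finally show ?thesis
    using assms by (simp add: is_b0_def add_divide_distrib)
qed

text \<open>Uniqueness: in \<open>1 + b + \<dots> + b ^ (r - 1) = 2 * r + r / (b - 1)\<close> the left side increases in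
  \<open>b\<close> and the right side strictly decreases.\<close>

lemma is_b0_ex1:
  assumes "2 \<le> r"
  shows "\<exists>!b. is_b0 r b"
proof -
  define f where "f b = b ^ r - 2 * real r * b + real r - 1" for b :: real
  have "f 1 < 0"
    using assms by (simp add: f_def)
  moreover have "0 \<le> f (2 * real r)"
  proof -
    have "(2 * real r) ^ 2 \<le> (2 * real r) ^ r"
      using assms by (intro power_increasing) auto
    then show ?thesis
      using assms by (simp add: f_def power2_eq_square)
  qed
  moreover have "continuous_on {1..2 * real r} f"
    unfolding f_def by (intro continuous_intros)
  ultimately obtain b where "1 \<le> b" "f b = 0"
    using IVT'[of f 1 0 "2 * real r"] assms by auto
  then have "is_b0 r b"
    using \<open>f 1 < 0\<close> by (cases "b = 1") (auto simp: is_b0_def f_def)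
  moreover have False if "is_b0 r a" "is_b0 r b" "a < b" for a b
  proof -
    have "(\<Sum>i<r. a ^ i) \<le> (\<Sum>i<r. b ^ i)"
      using that by (intro sum_mono power_mono) (auto simp: is_b0_def)
    moreover have "real r / (b - 1) < real r / (a - 1)"
      using that assms by (intro divide_strict_left_mono) (auto simp: is_b0_def)
    ultimately show False
      using that assms by (simp add: is_b0_geometric)
  qed
  ultimately show ?thesis
    by (metis linorder_neqE)
qed

text \<open>At the end \<open>2 * b * v\<close> of an interval starting at \<open>v\<close>, the
  covering estimate leaves \<open>(1 - 1 / r) * v\<close> uncovered; this form displays that
  share.\<close>

lemma density_bound_eq:
  assumes "is_b0 r b" "0 < r"
  shows "density_bound r b = 1 - (1 - 1 / real r) / (2 * b)"
  using assms by (simp add: density_bound_def is_b0_def field_simps)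

section \<open>Covering the subset sums of one block class\<close>

definition block :: "real \<Rightarrow> nat \<Rightarrow> nat" where
  "block b n = (LEAST k. ln (real n) < b ^ (k + 1))"

text \<open>Block 0 also takes all \<open>n\<close> with \<open>ln n < 1\<close>, whence the
  condition in the second bound.\<close>

lemma block_bounds:
  assumes "1 < b"
  shows "ln (real n) < b ^ (block b n + 1)"
    and "0 < block b n \<Longrightarrow> b ^ block b n \<le> ln (real n)"
proof -
  obtain k where "ln (real n) < b ^ k"
    using real_arch_pow[OF assms] by blast
  also have "b ^ k \<le> b ^ (k + 1)"
    using assms by (intro power_increasing) auto
  finally show "ln (real n) < b ^ (block b n + 1)"
    unfolding block_def by (rule LeastI)
  show "b ^ block b n \<le> ln (real n)" if "0 < block b n"
    using not_less_Least[of "block b n - 1" "\<lambda>k. ln (real n) < b ^ (k + 1)"] that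
    by (simp add: block_def)
qed

text \<open>The witness \<open>e\<close> is the largest summand. The summands are distinct, so there
  are at most \<open>e\<close> of them and \<open>e <= y <= e * e\<close>.\<close>

lemma subset_sum_ln_bounds:
  assumes b: "1 < b" and y: "y \<in> subset_sums A" "0 < y" and A: "\<And>n. n \<in> A \<Longrightarrow> 0 < n"
  shows "\<exists>e\<in>A. (0 < block b e \<longrightarrow> b ^ block b e \<le> ln (real y)) \<and> ln (real y) < 2 * b ^ (block b e + 1)"
proof -
  obtain S where S: "S \<subseteq> A" "finite S" "y = \<Sum>S"
    using y by (auto simp: subset_sums_def)
  define e where "e = Max S"
  have "S \<noteq> {}"
    using S y by auto
  then have e: "e \<in> S"
    using S by (simp add: e_def)
  then have "0 < e"
    using S A by auto
  have "e \<le> y"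
    unfolding S(3) using e S by (intro member_le_sum) auto
  have "S \<subseteq> {1..e}"
    using S A by (auto simp: e_def Suc_le_eq)
  then have "card S \<le> e"
    using card_mono[of "{1..e}" S] by simp
  have "y \<le> card S * e"
    unfolding S(3) using sum_bounded_above[of S "\<lambda>x. x" e] S by (simp add: e_def)
  also have "\<dots> \<le> e * e"
    using \<open>card S \<le> e\<close> by simp
  finally have "ln (real y) \<le> ln (real e * real e)"
    using y(2) \<open>0 < e\<close> by (subst ln_le_cancel_iff) (auto simp flip: of_nat_mult)
  also have "\<dots> = 2 * ln (real e)"
    using \<open>0 < e\<close> by (simp add: ln_mult)
  also have "\<dots> < 2 * b ^ (block b e + 1)"
    using block_bounds(1)[OF b, of e] by simp
  finally have "ln (real y) < 2 * b ^ (block b e + 1)" .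
  moreover have "ln (real e) \<le> ln (real y)"
    using \<open>0 < e\<close> \<open>e \<le> y\<close> by simp
  ultimately show ?thesis
    using e S block_bounds(2)[OF b, of e] by (intro bexI[of _ e]) auto
qed

text \<open>The equation for \<open>b\<close> reads \<open>b ^ r = r * (2 * b - 1) + 1\<close>. So
  adding the interval at \<open>v\<close>, of length \<open>(2 * b - 1) * v\<close>, raises the
  bound from \<open>v / r\<close> to exactly \<open>b ^ r * v / r\<close>.\<close>

lemma sum_geometric_progression_is_b0:
  assumes "is_b0 r b" "0 < r"
  shows "(\<Sum>j<J. (2 * b - 1) * b ^ (s + r * j)) \<le> b ^ (s + r * J) / real r"
proof (induction J)
  case 0
  show ?case
    using assms by (simp add: is_b0_def)
next
  case (Suc J)
  have "b ^ r = real r * (2 * b - 1) + 1"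
    using assms by (simp add: is_b0_def algebra_simps)
  then have "b ^ (s + r * Suc J) = b ^ (s + r * J) * (real r * (2 * b - 1) + 1)"
    by (simp add: power_add)
  then have "b ^ (s + r * Suc J) / real r = (2 * b - 1) * b ^ (s + r * J) + b ^ (s + r * J) / real r"
    using assms by (simp add: distrib_left add_divide_distrib)
  then show ?case
    using Suc by simp
qed

lemma sum_UN_le:
  fixes f :: "'a \<Rightarrow> real"
  assumes "finite I" "\<And>i. i \<in> I \<Longrightarrow> finite (E i)" "\<And>x. 0 \<le> f x"
  shows "(\<Sum>x\<in>(\<Union>i\<in>I. E i). f x) \<le> (\<Sum>i\<in>I. \<Sum>x\<in>E i. f x)"
  using assms
proof (induction I rule: finite_induct)
  case (insert i I)
  have "(\<Sum>x\<in>(\<Union>i\<in>insert i I. E i). f x) \<le> (\<Sum>x\<in>E i. f x) + (\<Sum>x\<in>(\<Union>i\<in>I. E i). f x)"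
    using insert by (simp add: sum_Un sum_nonneg)
  then show ?case
    using insert by simp
qed simp

lemma log_density_block_class_le:
  assumes b: "is_b0 r b" and r: "2 \<le> r" and "s < r" and x: "b ^ s \<le> ln x" "1 < x"
  defines "A \<equiv> {n. 0 < n \<and> block b n mod r = s}"
  shows "log_density (subset_sums A) x \<le>
    density_bound r b + (3 + 2 * b ^ (s + 1) + log b (ln x)) / ln x"
proof -
  define u where "u = ln x"
  have b1: "1 < b"
    using b by (simp add: is_b0_def)
  have "1 \<le> b ^ s"
    using b1 by simp
  then have u: "1 \<le> u"
    using x by (simp add: u_def)
  \<comment> \<open>The last interval of the class starting at or before \<open>u\<close>; for
    \<open>J = 0\<close> this rests on \<open>b ^ s <= ln x\<close>.\<close>
  define J where "J = (LEAST j. u < b ^ (s + r * (j + 1)))"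
  obtain k where "u < b ^ k"
    using real_arch_pow[OF b1] by blast
  also have "b ^ k \<le> b ^ (s + r * (k + 1))"
    using b1 r by (intro power_increasing) (auto simp: trans_le_add2)
  finally have J: "u < b ^ (s + r * (J + 1))"
    unfolding J_def by (rule LeastI)
  define v where "v = b ^ (s + r * J)"
  have v: "v \<le> u"
  proof (cases "J = 0")
    case False
    then show ?thesis
      using not_less_Least[of "J - 1" "\<lambda>j. u < b ^ (s + r * (j + 1))"]
      by (simp add: J_def v_def)
  qed (use x in \<open>simp add: v_def u_def\<close>)
  have v1: "1 \<le> v"
    using b1 by (simp add: v_def)
  define N where "N = {n. n \<in> subset_sums A \<and> 0 < n \<and> real n \<le> x}"
  define E where "E j = {n \<in> N. b ^ (s + r * j) \<le> ln (real n) \<and> ln (real n) < 2 * b ^ (s + r * j + 1)}" for j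
  \<comment> \<open>Catches the sums with largest element in block 0, where no lower bound is
    available.\<close>
  define E' where "E' = {n \<in> N. ln (real n) < 2 * b ^ (s + 1)}"
  have ln_le: "ln (real n) \<le> u" "0 \<le> ln (real n)" if "n \<in> N" for n
    using that x by (auto simp: N_def u_def)
  have pos: "0 < n" if "n \<in> N" for n
    using that by (simp add: N_def)
  have N_sub: "N \<subseteq> E' \<union> (\<Union>j\<in>{..J}. E j)"
  proof
    fix n assume n: "n \<in> N"
    then have n_sum: "n \<in> subset_sums A" "0 < n"
      by (simp_all add: N_def)
    have "0 < a" if "a \<in> A" for a
      using that by (simp add: A_def)
    from subset_sum_ln_bounds[OF b1 n_sum this]
    obtain e where "e \<in> A" "(0 < block b e \<longrightarrow> b ^ block b e \<le> ln (real n)) \<and>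
        ln (real n) < 2 * b ^ (block b e + 1)"
      by (rule bexE)
    note e = this(1) conjunct1[OF this(2)] conjunct2[OF this(2)]
    define j where "j = block b e div r"
    have "block b e mod r = s"
      using e(1) by (simp add: A_def)
    then have k: "block b e = s + r * j"
      using mod_mult_div_eq[of "block b e" r] by (simp add: j_def)
    show "n \<in> E' \<union> (\<Union>j\<in>{..J}. E j)"
    proof (cases "block b e = 0")
      case True
      have "b ^ 1 \<le> b ^ (s + 1)"
        using b1 by (intro power_increasing) auto
      then show ?thesis
        using n e True by (simp add: E'_def)
    next
      case False
      then have ge: "b ^ (s + r * j) \<le> ln (real n)"
        using e k by simp
      have "j \<le> J"
      proof (rule ccontr)
        assume "\<not> j \<le> J"
        then have "b ^ (s + r * (J + 1)) \<le> b ^ (s + r * j)"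
          using b1 by (intro power_increasing add_left_mono mult_left_mono) auto
        then show False
          using J ge ln_le(1)[OF n] by simp
      qed
      then show ?thesis
        using n e k ge by (auto simp: E_def)
    qed
  qed
  have E': "finite E'" "(\<Sum>n\<in>E'. 1 / real n) \<le> 1 + 2 * b ^ (s + 1)"
    using sum_inverse_le_if_ln_bounds[of E' 0 "2 * b ^ (s + 1)"] b1 ln_le pos
    by (auto simp: E'_def less_imp_le)
  have E: "finite (E j)" "(\<Sum>n\<in>E j. 1 / real n) \<le> 1 + (2 * b - 1) * b ^ (s + r * j)" for j
  proof -
    have "b ^ (s + r * j) \<le> 2 * b ^ (s + r * j + 1)"
      using b1 by simp
    then show "finite (E j)" "(\<Sum>n\<in>E j. 1 / real n) \<le> 1 + (2 * b - 1) * b ^ (s + r * j)"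
      using sum_inverse_le_if_ln_bounds[of "E j" "b ^ (s + r * j)" "2 * b ^ (s + r * j + 1)"] pos
      by (auto simp: E_def less_imp_le algebra_simps)
  qed
  have EJ: "(\<Sum>n\<in>E J. 1 / real n) \<le> 1 + min u (2 * b * v) - v"
  proof (rule sum_inverse_le_if_ln_bounds(2))
    have "1 * v \<le> 2 * b * v"
      using b1 v1 by (intro mult_right_mono) auto
    then show "v \<le> min u (2 * b * v)"
      using v by simp
    show "0 < n \<and> v \<le> ln (real n) \<and> ln (real n) \<le> min u (2 * b * v)" if "n \<in> E J" for n
      using that ln_le[of n] pos[of n] by (auto simp: E_def v_def)
  qed
  have "(\<Sum>n\<in>N. 1 / real n) \<le> (\<Sum>n\<in>E' \<union> (\<Union>j\<in>{..J}. E j). 1 / real n)"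
    using N_sub E E' by (intro sum_mono2) auto
  also have "\<dots> \<le> (\<Sum>n\<in>E'. 1 / real n) + (\<Sum>n\<in>(\<Union>j\<in>{..J}. E j). 1 / real n)"
    using E E' by (subst sum_Un) (auto intro!: sum_nonneg)
  also have "(\<Sum>n\<in>(\<Union>j\<in>{..J}. E j). 1 / real n) \<le> (\<Sum>j\<le>J. \<Sum>n\<in>E j. 1 / real n)"
    using E by (intro sum_UN_le) auto
  also have "(\<Sum>j\<le>J. \<Sum>n\<in>E j. 1 / real n) = (\<Sum>j<J. \<Sum>n\<in>E j. 1 / real n) + (\<Sum>n\<in>E J. 1 / real n)"
    by (simp flip: lessThan_Suc_atMost)
  also have "(\<Sum>j<J. \<Sum>n\<in>E j. 1 / real n) \<le> (\<Sum>j<J. 1 + (2 * b - 1) * b ^ (s + r * j))"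
    using E by (intro sum_mono) auto
  also have "\<dots> \<le> real J + v / real r"
    using sum_geometric_progression_is_b0[OF b, where J = J and s = s] r
    by (simp add: sum.distrib v_def)
  also note E'(2)
  also note EJ
  finally have "(\<Sum>n\<in>N. 1 / real n) \<le>
      2 + 2 * b ^ (s + 1) + real J + (v / real r + min u (2 * b * v) - v)"
    by simp
  \<comment> \<open>Relative to \<open>u\<close>, the left side rises until the interval ends at
    \<open>u = 2 * b * v\<close> and falls afterwards; its peak is the density bound.\<close>
  moreover have "v / real r + min u (2 * b * v) - v \<le> density_bound r b * u"
  proof -
    define q where "q = 1 - 1 / real r"
    have q: "0 < q" "q < 1"
      using r by (auto simp: q_def)
    have D: "density_bound r b * u = u - q * u / (2 * b)"
      using density_bound_eq[OF b] r by (simp add: q_def left_diff_distrib)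
    have L: "v / real r + min u (2 * b * v) - v = min u (2 * b * v) - q * v"
      by (simp add: q_def algebra_simps)
    show ?thesis
    proof (cases "u \<le> 2 * b * v")
      case True
      then have "q * u \<le> q * (2 * b * v)"
        using q by (intro mult_left_mono) auto
      then have "q * u / (2 * b) \<le> q * v"
        using b1 by (simp add: field_simps)
      then show ?thesis
        unfolding D L by simp
    next
      case False
      have "(1 - q / (2 * b)) * (2 * b * v) \<le> (1 - q / (2 * b)) * u"
        using False q b1 by (intro mult_left_mono) (auto simp: field_simps)
      then show ?thesis
        unfolding D L using False b1 by (simp add: algebra_simps)
    qed
  qed
  \<comment> \<open>Each interval costs an additive 1, but their starting points grow geometrically,
    so the total is only logarithmic in \<open>u\<close>.\<close>
  moreover have "real J \<le> log b u"
  proof -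
    have "J \<le> s + r * J"
      using r by (simp add: trans_le_add2)
    then have "b ^ J \<le> v"
      unfolding v_def using b1 by (intro power_increasing) auto
    then have "b powr real J \<le> u"
      using v b1 by (simp add: powr_realpow)
    then show ?thesis
      using b1 u by (subst le_log_iff) auto
  qed
  ultimately have "(\<Sum>n\<in>N. 1 / real n) \<le> 3 + 2 * b ^ (s + 1) + log b u + density_bound r b * u"
    by simp
  then have "(\<Sum>n\<in>N. 1 / real n) / u \<le>
      (3 + 2 * b ^ (s + 1) + log b u + density_bound r b * u) / u"
    using u by (intro divide_right_mono) auto
  also have "\<dots> = density_bound r b + (3 + 2 * b ^ (s + 1) + log b u) / u"
    using u by (simp add: add_divide_distrib)
  finally show ?thesis
    by (simp add: log_density_def N_def u_def)
qed

lemma upper_log_density_block_class_le: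
  assumes b: "is_b0 r b" and r: "2 \<le> r" "s < r"
  shows "upper_log_density (subset_sums {n. 0 < n \<and> block b n mod r = s}) \<le> ereal (density_bound r b)"
proof -
  define g where "g x = density_bound r b + (3 + 2 * b ^ (s + 1) + log b (ln x)) / ln x" for x
  have b1: "1 < b"
    using b by (simp add: is_b0_def)
  have "\<forall>\<^sub>F x in at_top. b ^ s \<le> ln x"
    by real_asymp
  then have "\<forall>\<^sub>F x in at_top.
      ereal (log_density (subset_sums {n. 0 < n \<and> block b n mod r = s}) x) \<le> ereal (g x)"
    using eventually_gt_at_top[of 1]
    by eventually_elim (use log_density_block_class_le[OF b r] in \<open>simp add: g_def\<close>)
  then have "upper_log_density (subset_sums {n. 0 < n \<and> block b n mod r = s}) \<le>
      Limsup at_top (\<lambda>x. ereal (g x))"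
    unfolding upper_log_density_def by (rule Limsup_mono)
  also have "(g \<longlongrightarrow> density_bound r b) at_top"
    unfolding g_def using b1 by real_asymp
  then have "Limsup at_top (\<lambda>x. ereal (g x)) = ereal (density_bound r b)"
    by (intro lim_imp_Limsup) auto
  finally show ?thesis .
qed

lemma exists_partition_density_bound:
  assumes b: "is_b0 r b" and r: "2 \<le> r"
  shows "\<exists>A. partition_of_positives r A \<and> max_density r A \<le> ereal (density_bound r b)"
proof -
  define A where "A i = {n. 0 < n \<and> block b n mod r = i - 1}" for i
  have "partition_of_positives r A"
    unfolding partition_of_positives_def
  proof
    show "disjoint_family_on A {1..r}"
      by (auto simp: disjoint_family_on_def A_def)
    have "n \<in> A (block b n mod r + 1)" "block b n mod r + 1 \<in> {1..r}" if "0 < n" for n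
      using that r by (auto simp: A_def Suc_le_eq)
    then have "{n. 0 < n} \<subseteq> (\<Union>i\<in>{1..r}. A i)"
      by blast
    moreover have "(\<Union>i\<in>{1..r}. A i) \<subseteq> {n. 0 < n}"
      by (auto simp: A_def)
    ultimately show "(\<Union>i\<in>{1..r}. A i) = {n. 0 < n}"
      by (rule equalityI[rotated])
  qed
  moreover have "max_density r A \<le> ereal (density_bound r b)"
    unfolding max_density_def
  proof (rule Max.boundedI)
    fix d assume "d \<in> (\<lambda>i. upper_log_density (subset_sums (A i))) ` {1..r}"
    then show "d \<le> ereal (density_bound r b)"
      using upper_log_density_block_class_le[OF b r] r by (auto simp: A_def)
  qed (use r in auto)
  ultimately show ?thesis
    by blast
qed

lemma density_bound_2:
  assumes "is_b0 2 b"
  shows "density_bound 2 b = (2 + sqrt 3) / 4"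
proof -
  \<comment> \<open>The polynomial is \<open>(b - 2)^2 - 3\<close>, and \<open>b > 1\<close> selects
    the root \<open>2 + sqrt 3\<close>.\<close>
  have "(b - 2)\<^sup>2 = 3" and "1 < b"
    using assms by (auto simp: is_b0_def power2_eq_square algebra_simps)
  then have "\<bar>b - 2\<bar> = sqrt 3"
    by (metis real_sqrt_abs)
  moreover have "1 < sqrt (3::real)"
    by simp
  ultimately have "b = 2 + sqrt 3"
    using \<open>1 < b\<close> by linarith
  moreover have "1 / (2 + sqrt 3) = 2 - sqrt (3::real)"
  proof -
    have "(2 - sqrt 3) * (2 + sqrt (3::real)) = 1"
      by (simp add: algebra_simps)
    moreover have "2 + sqrt (3::real) \<noteq> 0"
      using \<open>1 < sqrt 3\<close> by linarith
    ultimately show ?thesis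
      by (metis nonzero_mult_div_cancel_right)
  qed
  ultimately have "1 / b = 2 - sqrt 3"
    by simp
  moreover have "density_bound 2 b = 1 - 1 / 4 * (1 / b)"
    using density_bound_eq[OF assms] by simp
  ultimately show ?thesis
    by (simp add: field_simps)
qed

theorem theorem1p1:
  fixes r :: nat
  assumes "r \<ge> 2"
  shows "(\<exists>!b0. is_b0 r b0) \<and>
    (\<forall>b0. is_b0 r b0 \<longrightarrow>
      (\<exists>A. partition_of_positives r A \<and> max_density r A \<le> ereal (density_bound r b0)) \<and>
      c_min r \<le> ereal (density_bound r b0) \<and>
      (r = 2 \<longrightarrow>
        density_bound r b0 = (2 + sqrt 3) / 4 \<and>
        (\<forall>A. partition_of_positives 2 A \<longrightarrow>
          (\<exists>i\<in>{1, 2}. upper_log_density (subset_sums (A i)) \<ge> ereal ((2 + sqrt 3) / 4))) \<and>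
        c_min 2 = ereal ((2 + sqrt 3) / 4)))"
proof (intro conjI allI impI)
  show "\<exists>!b0. is_b0 r b0"
    using assms by (rule is_b0_ex1)
  fix b0 assume b0: "is_b0 r b0"
  show ex: "\<exists>A. partition_of_positives r A \<and> max_density r A \<le> ereal (density_bound r b0)"
    using exists_partition_density_bound[OF b0 assms] .
  then show c_min: "c_min r \<le> ereal (density_bound r b0)"
    unfolding c_min_def by (blast intro: Inf_lower2)
  assume [simp]: "r = 2"
  show bound: "density_bound r b0 = (2 + sqrt 3) / 4"
    using density_bound_2 b0 by simp
  show "\<exists>i\<in>{1, 2}. ereal ((2 + sqrt 3) / 4) \<le> upper_log_density (subset_sums (A i))"
    if "partition_of_positives 2 A" for A
    using partition_2_lower_bound[OF that] .
  show "c_min 2 = ereal ((2 + sqrt 3) / 4)"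
    using c_min[unfolded \<open>r = 2\<close> bound[unfolded \<open>r = 2\<close>]] c_min_2_ge by (rule antisym)
qed

end
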